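(* Let $\alpha,\beta\in\mathbb R$ and let $V(q_1,q_2)$ be one of the following potentials: either $$V(q_1,q_2)=\exp\left(\frac{-4q_1}{\beta}\right)f\left(\frac{\alpha q_1+\beta q_2}{\beta}\right)$$ with $\beta\neq0$ and $f$ an arbitrary smooth function of one variable, or $$V(q_1,q_2)=c_1\exp\left(\frac{-4q_1}{\beta}\right)+c_2\exp\left(\frac{4q_2}{\alpha}\right)$$ with $\alpha,\beta\neq0$ and arbitrary $c_1,c_2\in\mathbb R$. Let $H=\tfrac12(p_1^2+p_2^2)+V(q_1,q_2)$, let $P$ be the canonical Poisson bivector and $X=P\,dH=(p_1,p_2,-\partial_1V,-\partial_2V)$. Let $\tilde P$ be the bivector field with entries ($\partial_i=\partial/\partial q_i$) $$\tilde P^{12}=\alpha p_1+\beta p_2,\quad \tilde P^{13}=-\tilde P^{24}=p_1^2-p_2^2-\alpha\partial_2V+2V,$$ $$\tilde P^{14}=2p_1p_2-\beta\partial_2V,\quad \tilde P^{23}=2p_1p_2+\alpha\partial_1V,\quad \tilde P^{34}=2p_1\partial_2V-2p_2\partial_1V .$$ Then the flow of $X$ preserves both $P$ and $\tilde P$, i.e. $\mathcal L_XP=0$ and $\mathcal L_X\tilde P=0$, and $\tilde P$ has rank four at every point of an open dense subset of the phase space.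
   Context: Coordinates are $x=(x^1,x^2,x^3,x^4)=(q_1,q_2,p_1,p_2)$. The canonical Poisson bivector $P$ has entries $P^{13}=P^{24}=1$, $P^{31}=P^{42}=-1$ and all others zero; $(P\,dH)^i=\sum_jP^{ij}\partial_jH$. Bivectors are given by their skew-symmetric matrices of entries $B^{ij}=-B^{ji}$, and the rank is the rank of this matrix. $\mathcal L_X$ is the Lie derivative: $(\mathcal L_XB)^{ij}=\sum_k\left(X^k\partial_kB^{ij}-B^{kj}\partial_kX^i-B^{ik}\partial_kX^j\right)$. *)

theory Defs
  imports "HOL-Analysis.Analysis"
begin

definition smooth_real :: "(real \<Rightarrow> real) \<Rightarrow> bool" where
  "smooth_real f \<longleftrightarrow> (\<forall>n x. (deriv ^^ n) f differentiable (at x))"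

definition pderiv_at :: "'n \<Rightarrow> (real ^ 'n \<Rightarrow> real) \<Rightarrow> real ^ 'n \<Rightarrow> real" where
  "pderiv_at k F x = deriv (\<lambda>t. F (\<chi> j. if j = k then t else x $ j)) (x $ k)"

text \<open>A bivector field is a field of skew-symmetric matrices; \<open>B x $ i $ j\<close> is the entry
  \<open>B\<^sup>i\<^sup>j\<close> at the point \<open>x\<close>.\<close>

definition contract_d ::
    "(real ^ 'n \<Rightarrow> real ^ 'n ^ 'n) \<Rightarrow> (real ^ 'n \<Rightarrow> real) \<Rightarrow> real ^ 'n \<Rightarrow> real ^ 'n" where
  "contract_d B H x = (\<chi> i. \<Sum>j\<in>UNIV. B x $ i $ j * pderiv_at j H x)"

definition lie_bivector ::
    "(real ^ 'n \<Rightarrow> real ^ 'n) \<Rightarrow> (real ^ 'n \<Rightarrow> real ^ 'n ^ 'n) \<Rightarrow> real ^ 'n \<Rightarrow> real ^ 'n ^ 'n" where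
  "lie_bivector X B x = (\<chi> i j. \<Sum>k\<in>UNIV.
      X x $ k * pderiv_at k (\<lambda>y. B y $ i $ j) x
      - B x $ k $ j * pderiv_at k (\<lambda>y. X y $ i) x
      - B x $ i $ k * pderiv_at k (\<lambda>y. X y $ j) x)"

definition skew4 :: "real \<Rightarrow> real \<Rightarrow> real \<Rightarrow> real \<Rightarrow> real \<Rightarrow> real \<Rightarrow> real ^ 4 ^ 4" where
  "skew4 b12 b13 b14 b23 b24 b34 = vector
    [vector [0, b12, b13, b14],
     vector [- b12, 0, b23, b24],
     vector [- b13, - b23, 0, b34],
     vector [- b14, - b24, - b34, 0]]"

text \<open>Phase space is \<open>real ^ 4\<close> with coordinates
  \<open>(x $ 1, x $ 2, x $ 3, x $ 4) = (q\<^sub>1, q\<^sub>2, p\<^sub>1, p\<^sub>2)\<close>.\<close>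

definition canonical_P :: "real ^ 4 \<Rightarrow> real ^ 4 ^ 4" where
  "canonical_P x = skew4 0 1 0 0 1 0"

definition natural_H :: "(real \<Rightarrow> real \<Rightarrow> real) \<Rightarrow> real ^ 4 \<Rightarrow> real" where
  "natural_H V x = 1 / 2 * ((x $ 3)\<^sup>2 + (x $ 4)\<^sup>2) + V (x $ 1) (x $ 2)"

definition hamiltonian_vf :: "(real \<Rightarrow> real \<Rightarrow> real) \<Rightarrow> real ^ 4 \<Rightarrow> real ^ 4" where
  "hamiltonian_vf V = contract_d canonical_P (natural_H V)"

definition dq1 :: "(real \<Rightarrow> real \<Rightarrow> real) \<Rightarrow> real \<Rightarrow> real \<Rightarrow> real" where
  "dq1 V q1 q2 = deriv (\<lambda>t. V t q2) q1"

definition dq2 :: "(real \<Rightarrow> real \<Rightarrow> real) \<Rightarrow> real \<Rightarrow> real \<Rightarrow> real" where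
  "dq2 V q1 q2 = deriv (\<lambda>t. V q1 t) q2"

definition tilde_P :: "real \<Rightarrow> real \<Rightarrow> (real \<Rightarrow> real \<Rightarrow> real) \<Rightarrow> real ^ 4 \<Rightarrow> real ^ 4 ^ 4" where
  "tilde_P \<alpha> \<beta> V x =
    (let q1 = x $ 1; q2 = x $ 2; p1 = x $ 3; p2 = x $ 4;
         V0 = V q1 q2; V1 = dq1 V q1 q2; V2 = dq2 V q1 q2;
         d = p1\<^sup>2 - p2\<^sup>2 - \<alpha> * V2 + 2 * V0
     in skew4
          (\<alpha> * p1 + \<beta> * p2)
          d
          (2 * p1 * p2 - \<beta> * V2)
          (2 * p1 * p2 + \<alpha> * V1)
          (- d)
          (2 * p1 * V2 - 2 * p2 * V1))"

lemma vector_4 [simp]: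
  "(vector [w, x, y, z] :: 'a::zero ^ 4) $ 1 = w"
  "(vector [w, x, y, z] :: 'a::zero ^ 4) $ 2 = x"
  "(vector [w, x, y, z] :: 'a::zero ^ 4) $ 3 = y"
  "(vector [w, x, y, z] :: 'a::zero ^ 4) $ 4 = z"
  unfolding vector_def by simp_all

lemma transpose_skew4: "transpose (skew4 a b c d e f) = - skew4 a b c d e f"
  by (simp add: vec_eq_iff forall_4 transpose_def skew4_def)

lemma deriv_const_add: "deriv (\<lambda>t. c + g t) x = deriv g x" for g :: "real \<Rightarrow> real"
proof -
  have "((\<lambda>t. c + g t) has_field_derivative D) (at x) \<longleftrightarrow> (g has_field_derivative D) (at x)" for D
  proof
    assume "((\<lambda>t. c + g t) has_field_derivative D) (at x)"
    from DERIV_add[OF DERIV_const[of "- c"] this]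
    show "(g has_field_derivative D) (at x)" by simp
  next
    assume "(g has_field_derivative D) (at x)"
    from DERIV_add[OF DERIV_const[of c] this]
    show "((\<lambda>t. c + g t) has_field_derivative D) (at x)" by simp
  qed
  then show ?thesis by (simp add: deriv_def)
qed

lemma hamiltonian_vf_eq:
  "hamiltonian_vf V x =
    vector [x $ 3, x $ 4, - dq1 V (x $ 1) (x $ 2), - dq2 V (x $ 1) (x $ 2)]"
proof -
  have 1: "pderiv_at 1 (natural_H V) x = dq1 V (x $ 1) (x $ 2)"
    by (simp add: pderiv_at_def natural_H_def dq1_def deriv_const_add)
  have 2: "pderiv_at 2 (natural_H V) x = dq2 V (x $ 1) (x $ 2)"
    by (simp add: pderiv_at_def natural_H_def dq2_def deriv_const_add)
  have 3: "pderiv_at 3 (natural_H V) x = x $ 3"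
    unfolding pderiv_at_def natural_H_def
    by (rule DERIV_imp_deriv) (auto intro!: derivative_eq_intros)
  have 4: "pderiv_at 4 (natural_H V) x = x $ 4"
    unfolding pderiv_at_def natural_H_def
    by (rule DERIV_imp_deriv) (auto intro!: derivative_eq_intros)
  show ?thesis
    by (simp add: vec_eq_iff forall_4 hamiltonian_vf_def contract_d_def canonical_P_def
        skew4_def sum_4 1 2 3 4)
qed

end

theory Submission
  imports Defs "HOL-Computational_Algebra.Polynomial"
begin

text \<open>
  For an arbitrary potential, all entries of the Lie derivative of the second bivector are
  combinations of the three expressions
  \<open>4 V\<^sub>2 - \<alpha> V\<^sub>2\<^sub>2 + \<beta> V\<^sub>1\<^sub>2\<close>, \<open>4 V\<^sub>1 - \<alpha> V\<^sub>1\<^sub>2 + \<beta> V\<^sub>1\<^sub>1\<close> and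
  \<open>V\<^sub>1\<^sub>2 (4 V - \<alpha> V\<^sub>2 + \<beta> V\<^sub>1)\<close>.
  In the first family \<open>4 V - \<alpha> V\<^sub>2 + \<beta> V\<^sub>1 = 0\<close>, and the two other equations are its
  derivatives; in the second family \<open>V\<^sub>1\<^sub>2 = 0\<close>. For fixed \<open>q\<close> the Pfaffian of the second
  bivector is a polynomial in \<open>p\<close> with leading part \<open>(p\<^sub>1\<^sup>2 + p\<^sub>2\<^sup>2)\<^sup>2\<close>, so along every line
  in the direction \<open>p\<^sub>1\<close> it has only finitely many zeros.
\<close>

definition pfaffian4 :: "real ^ 4 ^ 4 \<Rightarrow> real" where
  "pfaffian4 A = A $ 1 $ 2 * A $ 3 $ 4 - A $ 1 $ 3 * A $ 2 $ 4 + A $ 1 $ 4 * A $ 2 $ 3"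

lemma skew4_nth [simp]:
  "skew4 a b c d e f $ 1 $ 1 = 0" "skew4 a b c d e f $ 1 $ 2 = a"
  "skew4 a b c d e f $ 1 $ 3 = b" "skew4 a b c d e f $ 1 $ 4 = c"
  "skew4 a b c d e f $ 2 $ 1 = - a" "skew4 a b c d e f $ 2 $ 2 = 0"
  "skew4 a b c d e f $ 2 $ 3 = d" "skew4 a b c d e f $ 2 $ 4 = e"
  "skew4 a b c d e f $ 3 $ 1 = - b" "skew4 a b c d e f $ 3 $ 2 = - d"
  "skew4 a b c d e f $ 3 $ 3 = 0" "skew4 a b c d e f $ 3 $ 4 = f"
  "skew4 a b c d e f $ 4 $ 1 = - c" "skew4 a b c d e f $ 4 $ 2 = - e"
  "skew4 a b c d e f $ 4 $ 3 = - f" "skew4 a b c d e f $ 4 $ 4 = 0"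
  by (simp_all add: skew4_def)

lemma pfaffian4_skew4: "pfaffian4 (skew4 a b c d e f) = a * f - b * e + c * d"
  by (simp add: pfaffian4_def)

text \<open>The left factor is minus the Hodge dual: complementary index pairs are exchanged with
  the sign of the permutation. It plays the role of the adjugate, with the Pfaffian in place of the
  determinant.\<close>

lemma skew4_dual_mult:
  "skew4 (- f) e (- d) (- c) b (- a) ** skew4 a b c d e f = mat (a * f - b * e + c * d)"
  by (simp add: vec_eq_iff forall_4 matrix_matrix_mult_def sum_4 mat_def algebra_simps)

text \<open>A nonzero Pfaffian makes the dual matrix a left inverse up to a nonzero scalar, so the
  matrix acts injectively.\<close>

lemma rank_skew4:
  assumes "pfaffian4 (skew4 a b c d e f) \<noteq> 0"
  shows "rank (skew4 a b c d e f) = 4"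
proof -
  let ?A = "skew4 a b c d e f" and ?B = "skew4 (- f) e (- d) (- c) b (- a)"
  let ?r = "a * f - b * e + c * d"
  have "inj ((*v) ?A)"
  proof (rule injI)
    fix v w assume "?A *v v = ?A *v w"
    then have "(?B ** ?A) *v v = (?B ** ?A) *v w"
      by (simp flip: matrix_vector_mul_assoc)
    then have "mat ?r *v v = mat ?r *v w"
      by (simp only: skew4_dual_mult)
    then show "v = w"
      using assms
      by (simp add: vec_eq_iff forall_4 matrix_vector_mult_def sum_4 mat_def pfaffian4_skew4)
  qed
  then show ?thesis
    by (simp flip: full_rank_injective)
qed

lemma pderiv_at_eqI:
  assumes "((\<lambda>t. F (\<chi> j. if j = k then t else x $ j)) has_field_derivative D) (at (x $ k))"
  shows "pderiv_at k F x = D"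
  unfolding pderiv_at_def using assms by (rule DERIV_imp_deriv)

lemma pderiv_at_const: "pderiv_at k (\<lambda>y. c) x = 0"
  by (simp add: pderiv_at_def)

text \<open>Finitely many bad parameters cannot accumulate at 0, so the points of the line through
  \<open>x\<close> lie in \<open>S\<close> for all small nonzero \<open>t\<close>, and they tend to
  \<open>x\<close>.\<close>

lemma closure_eq_UNIV_if_finite_on_lines:
  fixes S :: "'a::real_normed_vector set" and v :: 'a
  assumes "\<And>x. finite {t. x + t *\<^sub>R v \<notin> S}"
  shows "closure S = UNIV"
proof (intro UNIV_eq_I[symmetric])
  fix x
  have "finite ({t. x + t *\<^sub>R v \<notin> S} \<union> {0})"
    using assms by simp
  from islimpt_finite[OF this, of 0] have "\<forall>\<^sub>F t in at (0::real). x + t *\<^sub>R v \<in> S"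
    by (auto simp: islimpt_def eventually_at_topological)
  moreover have "((\<lambda>t. x + t *\<^sub>R v) \<longlongrightarrow> x + 0 *\<^sub>R v) (at (0::real))"
    by (intro tendsto_intros)
  ultimately show "x \<in> closure S"
    using Lim_in_closed_set[of "closure S" "\<lambda>t. x + t *\<^sub>R v" "at (0::real)"]
    by (simp add: eventually_mono closure_subset[THEN subsetD])
qed

text \<open>Explicit partial derivatives let both families be handled by interpretation. The single
  \<open>V12\<close> for both mixed derivatives encodes the symmetry of the Hessian.\<close>

locale potential =
  fixes V V1 V2 V11 V12 V22 :: "real \<Rightarrow> real \<Rightarrow> real"
  assumes V_q1: "\<And>a b. ((\<lambda>t. V t b) has_field_derivative V1 a b) (at a)"
    and V_q2: "\<And>a b. ((\<lambda>t. V a t) has_field_derivative V2 a b) (at b)"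
    and V1_q1: "\<And>a b. ((\<lambda>t. V1 t b) has_field_derivative V11 a b) (at a)"
    and V1_q2: "\<And>a b. ((\<lambda>t. V1 a t) has_field_derivative V12 a b) (at b)"
    and V2_q1: "\<And>a b. ((\<lambda>t. V2 t b) has_field_derivative V12 a b) (at a)"
    and V2_q2: "\<And>a b. ((\<lambda>t. V2 a t) has_field_derivative V22 a b) (at b)"
begin

lemma dq1_eq: "dq1 V = V1" and dq2_eq: "dq2 V = V2"
  using V_q1 V_q2 by (auto simp: fun_eq_iff dq1_def dq2_def intro: DERIV_imp_deriv)

lemmas V_derivs = V_q1 V_q2 V1_q1 V1_q2 V2_q1 V2_q2

lemma pderiv_hamiltonian_vf:
  "pderiv_at 1 (\<lambda>y. hamiltonian_vf V y $ i) x
     = vector [0, 0, - V11 (x $ 1) (x $ 2), - V12 (x $ 1) (x $ 2)] $ i"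
  "pderiv_at 2 (\<lambda>y. hamiltonian_vf V y $ i) x
     = vector [0, 0, - V12 (x $ 1) (x $ 2), - V22 (x $ 1) (x $ 2)] $ i"
  "pderiv_at 3 (\<lambda>y. hamiltonian_vf V y $ i) x = vector [1, 0, 0, 0] $ i"
  "pderiv_at 4 (\<lambda>y. hamiltonian_vf V y $ i) x = vector [0, 1, 0, 0] $ i"
  using exhaust_4[of i]
  by (auto simp: hamiltonian_vf_eq dq1_eq dq2_eq
      intro!: pderiv_at_eqI derivative_eq_intros V_derivs)

text \<open>The 34 entry is the difference of the two mixed derivatives of \<open>V\<close>; its
  vanishing is the symmetry built into the locale.\<close>

lemma lie_canonical_P: "lie_bivector (hamiltonian_vf V) canonical_P x = 0"
  by (simp add: vec_eq_iff forall_4 lie_bivector_def sum_4 pderiv_hamiltonian_vf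
      canonical_P_def pderiv_at_const)

abbreviation "diag_entry \<alpha> y \<equiv>
  (y $ 3)\<^sup>2 - (y $ 4)\<^sup>2 - \<alpha> * V2 (y $ 1) (y $ 2) + 2 * V (y $ 1) (y $ 2)"

lemma tilde_P_eq:
  "tilde_P \<alpha> \<beta> V x =
     skew4 (\<alpha> * x $ 3 + \<beta> * x $ 4) (diag_entry \<alpha> x)
       (2 * x $ 3 * x $ 4 - \<beta> * V2 (x $ 1) (x $ 2))
       (2 * x $ 3 * x $ 4 + \<alpha> * V1 (x $ 1) (x $ 2)) (- diag_entry \<alpha> x)
       (2 * x $ 3 * V2 (x $ 1) (x $ 2) - 2 * x $ 4 * V1 (x $ 1) (x $ 2))"
  by (simp add: tilde_P_def Let_def dq1_eq dq2_eq)

lemma pderiv_tilde_P: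
  "pderiv_at 1 (\<lambda>y. tilde_P \<alpha> \<beta> V y $ i $ j) x =
     skew4 0 (2 * V1 (x $ 1) (x $ 2) - \<alpha> * V12 (x $ 1) (x $ 2))
       (- \<beta> * V12 (x $ 1) (x $ 2)) (\<alpha> * V11 (x $ 1) (x $ 2))
       (\<alpha> * V12 (x $ 1) (x $ 2) - 2 * V1 (x $ 1) (x $ 2))
       (2 * x $ 3 * V12 (x $ 1) (x $ 2) - 2 * x $ 4 * V11 (x $ 1) (x $ 2)) $ i $ j"
  "pderiv_at 2 (\<lambda>y. tilde_P \<alpha> \<beta> V y $ i $ j) x =
     skew4 0 (2 * V2 (x $ 1) (x $ 2) - \<alpha> * V22 (x $ 1) (x $ 2))
       (- \<beta> * V22 (x $ 1) (x $ 2)) (\<alpha> * V12 (x $ 1) (x $ 2))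
       (\<alpha> * V22 (x $ 1) (x $ 2) - 2 * V2 (x $ 1) (x $ 2))
       (2 * x $ 3 * V22 (x $ 1) (x $ 2) - 2 * x $ 4 * V12 (x $ 1) (x $ 2)) $ i $ j"
  "pderiv_at 3 (\<lambda>y. tilde_P \<alpha> \<beta> V y $ i $ j) x =
     skew4 \<alpha> (2 * x $ 3) (2 * x $ 4) (2 * x $ 4) (- 2 * x $ 3)
       (2 * V2 (x $ 1) (x $ 2)) $ i $ j"
  "pderiv_at 4 (\<lambda>y. tilde_P \<alpha> \<beta> V y $ i $ j) x =
     skew4 \<beta> (- 2 * x $ 4) (2 * x $ 3) (2 * x $ 3) (2 * x $ 4)
       (- 2 * V1 (x $ 1) (x $ 2)) $ i $ j"
  using exhaust_4[of i] exhaust_4[of j]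
  by (auto simp: tilde_P_eq intro!: pderiv_at_eqI derivative_eq_intros V_derivs)

lemma lie_tilde_P:
  assumes E2: "\<And>a b. 4 * V2 a b - \<alpha> * V22 a b + \<beta> * V12 a b = 0"
    and E1: "\<And>a b. 4 * V1 a b - \<alpha> * V12 a b + \<beta> * V11 a b = 0"
    and E0: "\<And>a b. V12 a b * (4 * V a b - \<alpha> * V2 a b + \<beta> * V1 a b) = 0"
  shows "lie_bivector (hamiltonian_vf V) (tilde_P \<alpha> \<beta> V) x = 0"
proof -
  define q1 q2 p1 p2 where q: "q1 = x $ 1" "q2 = x $ 2" "p1 = x $ 3" "p2 = x $ 4"
  \<comment> \<open>Each label names the matrix entry that the expression equals up to sign. The 24
    entry is minus the 13 entry, and the 12 entry cancels identically.\<close>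
  have 13: "p2 * (4 * V2 q1 q2 - \<alpha> * V22 q1 q2 + \<beta> * V12 q1 q2) = 0"
    and 14: "p1 * (4 * V2 q1 q2 - \<alpha> * V22 q1 q2 + \<beta> * V12 q1 q2) = 0"
    and 23: "p2 * (4 * V1 q1 q2 - \<alpha> * V12 q1 q2 + \<beta> * V11 q1 q2) = 0"
    using E1 E2 by simp_all
  \<comment> \<open>In the 34 entry all momenta cancel. What remains is this combination, in which
    the terms \<open>4 * V1 * V2\<close> and \<open>\<beta> * V1 * V12\<close> drop out.\<close>
  have 34: "V1 q1 q2 * (4 * V2 q1 q2 - \<alpha> * V22 q1 q2 + \<beta> * V12 q1 q2)
      - V2 q1 q2 * (4 * V1 q1 q2 - \<alpha> * V12 q1 q2 + \<beta> * V11 q1 q2)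
      - V12 q1 q2 * (4 * V q1 q2 - \<alpha> * V2 q1 q2 + \<beta> * V1 q1 q2) = 0"
    by (simp only: E0 E1 E2)
  show ?thesis
    \<comment> \<open>The derivatives are rewritten first, while the components are still folded as
      the derivative lemmas expect; only then are the values expanded.\<close>
    unfolding vec_eq_iff forall_4 lie_bivector_def vec_lambda_beta sum_4
      pderiv_hamiltonian_vf pderiv_tilde_P
    unfolding hamiltonian_vf_eq dq1_eq dq2_eq tilde_P_eq skew4_nth vector_4 zero_index
      q[symmetric]
    using 13 14 23 34 by (intro conjI; simp add: algebra_simps power2_eq_square)
qed

lemma open_pfaffian_tilde_P:
  assumes "continuous_on UNIV (\<lambda>x::real^4. V1 (x $ 1) (x $ 2))"
    and "continuous_on UNIV (\<lambda>x::real^4. V2 (x $ 1) (x $ 2))"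
    and "continuous_on UNIV (\<lambda>x::real^4. V (x $ 1) (x $ 2))"
  shows "open {x. pfaffian4 (tilde_P \<alpha> \<beta> V x) \<noteq> 0}"
  unfolding tilde_P_eq pfaffian4_skew4
  by (intro open_Collect_neq continuous_intros assms)

lemma finite_zeros_pfaffian_tilde_P:
  "finite {t. pfaffian4 (tilde_P \<alpha> \<beta> V (x + t *\<^sub>R axis 3 1)) = 0}"
proof -
  define a b v v1 v2 where "a = x $ 3" and "b = x $ 4" and "v = V (x $ 1) (x $ 2)"
    and "v1 = V1 (x $ 1) (x $ 2)" and "v2 = V2 (x $ 1) (x $ 2)"
  \<comment> \<open>As polynomials in \<open>t\<close>, \<open>A\<close> is the first momentum along
    the line and \<open>D\<close> the 13 entry. The 24 entry is \<open>- D\<close>, whence the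
    summand \<open>D\<^sup>2\<close> in \<open>p\<close>.\<close>
  define A :: "real poly" where "A = [:a, 1:]"
  define D where "D = A\<^sup>2 + [:- b\<^sup>2 - \<alpha> * v2 + 2 * v:]"
  define p where "p = [:\<alpha> * a + \<beta> * b, \<alpha>:] * [:2 * a * v2 - 2 * b * v1, 2 * v2:] + D\<^sup>2
    + [:2 * a * b - \<beta> * v2, 2 * b:] * [:2 * a * b + \<alpha> * v1, 2 * b:]"
  \<comment> \<open>\<open>D\<close> is monic quadratic, and the other two summands of
    \<open>p\<close> have degree at most 2.\<close>
  have "coeff p 4 = 1"
    by (simp add: p_def D_def A_def power2_eq_square coeff_pCons numeral_eq_Suc)
  then have "p \<noteq> 0"
    by auto
  moreover have "pfaffian4 (tilde_P \<alpha> \<beta> V (x + t *\<^sub>R axis 3 1)) = poly p t" for t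
    unfolding tilde_P_eq pfaffian4_skew4
    by (simp add: p_def D_def A_def a_def b_def v_def v1_def v2_def axis_def algebra_simps
        power2_eq_square)
  ultimately show ?thesis
    by (simp add: poly_roots_finite)
qed

lemma tilde_P_invariant_and_generically_nondegenerate:
  assumes "\<And>a b. 4 * V2 a b - \<alpha> * V22 a b + \<beta> * V12 a b = 0"
    and "\<And>a b. 4 * V1 a b - \<alpha> * V12 a b + \<beta> * V11 a b = 0"
    and "\<And>a b. V12 a b * (4 * V a b - \<alpha> * V2 a b + \<beta> * V1 a b) = 0"
    and "continuous_on UNIV (\<lambda>x::real^4. V1 (x $ 1) (x $ 2))"
    and "continuous_on UNIV (\<lambda>x::real^4. V2 (x $ 1) (x $ 2))"
    and "continuous_on UNIV (\<lambda>x::real^4. V (x $ 1) (x $ 2))"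
  shows "(\<forall>x. lie_bivector (hamiltonian_vf V) canonical_P x = 0) \<and>
         (\<forall>x. lie_bivector (hamiltonian_vf V) (tilde_P \<alpha> \<beta> V) x = 0) \<and>
         (\<exists>U. open U \<and> closure U = UNIV \<and> (\<forall>x\<in>U. rank (tilde_P \<alpha> \<beta> V x) = 4))"
proof (intro conjI allI exI)
  let ?U = "{x. pfaffian4 (tilde_P \<alpha> \<beta> V x) \<noteq> 0}"
  show "open ?U"
    using assms by (intro open_pfaffian_tilde_P)
  show "closure ?U = UNIV"
    by (rule closure_eq_UNIV_if_finite_on_lines[where v = "axis 3 1"])
      (simp add: finite_zeros_pfaffian_tilde_P)
  show "\<forall>x\<in>?U. rank (tilde_P \<alpha> \<beta> V x) = 4"
    by (auto simp: tilde_P_eq intro!: rank_skew4)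
qed (use assms in \<open>auto intro: lie_canonical_P lie_tilde_P\<close>)

end

lemma smooth_real_derivs:
  assumes "smooth_real f"
  shows "(f has_field_derivative deriv f x) (at x)"
    and "(deriv f has_field_derivative deriv (deriv f) x) (at x)"
proof -
  from assms have "(deriv ^^ n) f differentiable (at x)" for n
    by (simp add: smooth_real_def)
  from this[of 0] this[of 1] show "(f has_field_derivative deriv f x) (at x)"
    and "(deriv f has_field_derivative deriv (deriv f) x) (at x)"
    by (simp_all add: DERIV_deriv_iff_real_differentiable)
qed

theorem proposition4:
  fixes \<alpha> \<beta> :: real and V :: "real \<Rightarrow> real \<Rightarrow> real"
  assumes "(\<beta> \<noteq> 0 \<and> (\<exists>f. smooth_real f \<and>
              V = (\<lambda>q1 q2. exp (- 4 * q1 / \<beta>) * f ((\<alpha> * q1 + \<beta> * q2) / \<beta>)))) \<or>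
           (\<alpha> \<noteq> 0 \<and> \<beta> \<noteq> 0 \<and> (\<exists>c1 c2 :: real.
              V = (\<lambda>q1 q2. c1 * exp (- 4 * q1 / \<beta>) + c2 * exp (4 * q2 / \<alpha>))))"
  shows "(\<forall>x. lie_bivector (hamiltonian_vf V) canonical_P x = 0) \<and>
         (\<forall>x. lie_bivector (hamiltonian_vf V) (tilde_P \<alpha> \<beta> V) x = 0) \<and>
         (\<exists>U. open U \<and> closure U = UNIV \<and> (\<forall>x\<in>U. rank (tilde_P \<alpha> \<beta> V x) = 4))"
  using assms
proof (elim disjE conjE exE)
  fix f
  assume \<beta>: "\<beta> \<noteq> 0" and f: "smooth_real f"
    and V: "V = (\<lambda>q1 q2. exp (- 4 * q1 / \<beta>) * f ((\<alpha> * q1 + \<beta> * q2) / \<beta>))"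
  define g h where "g = deriv f" and "h = deriv g"
  have f': "(f has_field_derivative g x) (at x)"
    and g': "(g has_field_derivative h x) (at x)" for x
    using smooth_real_derivs[OF f] by (simp_all add: g_def h_def)
  note [derivative_intros] = DERIV_chain2[OF f'] DERIV_chain2[OF g']
  have cont: "continuous_on UNIV f" "continuous_on UNIV g"
    using f' g' by (meson DERIV_isCont continuous_at_imp_continuous_on)+
  note [continuous_intros] = continuous_on_compose2[OF cont(1)] continuous_on_compose2[OF cont(2)]
  let ?e = "\<lambda>q1. exp (- 4 * q1 / \<beta>)" and ?u = "\<lambda>q1 q2. (\<alpha> * q1 + \<beta> * q2) / \<beta>"
  \<comment> \<open>The argument of \<open>f\<close> has slope \<open>\<alpha> / \<beta>\<close> in
    \<open>q1\<close> and slope 1 in \<open>q2\<close>, so only derivatives in \<open>q1\<close>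
    bring a denominator.\<close>
  let ?V1 = "\<lambda>q1 q2. ?e q1 * (\<alpha> * g (?u q1 q2) - 4 * f (?u q1 q2)) / \<beta>"
  let ?V2 = "\<lambda>q1 q2. ?e q1 * g (?u q1 q2)"
  let ?V11 = "\<lambda>q1 q2. ?e q1 *
    (\<alpha>\<^sup>2 * h (?u q1 q2) - 8 * \<alpha> * g (?u q1 q2) + 16 * f (?u q1 q2)) / \<beta>\<^sup>2"
  let ?V12 = "\<lambda>q1 q2. ?e q1 * (\<alpha> * h (?u q1 q2) - 4 * g (?u q1 q2)) / \<beta>"
  let ?V22 = "\<lambda>q1 q2. ?e q1 * h (?u q1 q2)"
  interpret potential V ?V1 ?V2 ?V11 ?V12 ?V22
    unfolding V
    by unfold_locales
      (use \<beta> in \<open>auto intro!: derivative_eq_intros simp: field_simps power2_eq_square\<close>)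
  show ?thesis
  proof (rule tilde_P_invariant_and_generically_nondegenerate)
    show "continuous_on UNIV (\<lambda>x::real^4. V (x $ 1) (x $ 2))"
      unfolding V using \<beta> by (auto intro!: continuous_intros)
  qed (use \<beta> in \<open>auto intro!: continuous_intros simp: V field_simps power2_eq_square\<close>)
next
  fix c1 c2
  assume \<alpha>: "\<alpha> \<noteq> 0" and \<beta>: "\<beta> \<noteq> 0"
    and V: "V = (\<lambda>q1 q2. c1 * exp (- 4 * q1 / \<beta>) + c2 * exp (4 * q2 / \<alpha>))"
  let ?V1 = "\<lambda>q1 (q2::real). - 4 * c1 / \<beta> * exp (- 4 * q1 / \<beta>)"
  let ?V2 = "\<lambda>(q1::real) q2. 4 * c2 / \<alpha> * exp (4 * q2 / \<alpha>)"
  let ?V11 = "\<lambda>q1 (q2::real). 16 * c1 / \<beta>\<^sup>2 * exp (- 4 * q1 / \<beta>)"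
  let ?V22 = "\<lambda>(q1::real) q2. 16 * c2 / \<alpha>\<^sup>2 * exp (4 * q2 / \<alpha>)"
  \<comment> \<open>The variables separate, so the mixed derivative is 0. The exponents are such
    that \<open>4 * V1 + \<beta> * V11\<close> and \<open>4 * V2 - \<alpha> * V22\<close>
    vanish.\<close>
  interpret potential V ?V1 ?V2 ?V11 "\<lambda>_ _. 0" ?V22
    unfolding V
    by unfold_locales
      (use \<alpha> \<beta> in \<open>auto intro!: derivative_eq_intros simp: field_simps power2_eq_square\<close>)
  show ?thesis
    by (rule tilde_P_invariant_and_generically_nondegenerate)
      (use \<alpha> \<beta> in \<open>auto intro!: continuous_intros simp: V field_simps power2_eq_square\<close>)
qed

end
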